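(* Let $r\ge 0$ and $m\ge r+1$, and let $\boldsymbol{G}$ be the standard generator matrix of the binary Reed--Muller code $\mathrm{RM}(r,m)$, of dimension $k$. Let $\boldsymbol{\lambda}=(\lambda_1,\dots,\lambda_k)\in\mathcal{S}(\boldsymbol{G})$. Then for any two message symbols $s_i$ and $s_j$ ($i,j\in[k]$) of orders $\ell_1$ and $\ell_2$, respectively, with $0\le\ell_1<\ell_2\le r$, $$(2^{r+1}-2^{\ell_1})\lambda_i+(2^{r+1}-2^{\ell_2})\lambda_j\le 2^m+2^{r+1}-2^{\ell_1+1}.$$
   Context: Notation: $[a]=\{1,\dots,a\}$; $\boldsymbol{e}_i$ is the $i$-th unit vector of length $k$. Reed--Muller code and generator matrix. For $0\le r\le m$, the binary code $\mathrm{RM}(r,m)$ consists of the evaluation vectors, over all $2^m$ points of $\mathbb{F}_2^m$, of the polynomials of degree at most $r$ in $m$ binary variables $v_1,\dots,v_m$. It has length $n=2^m$ and dimension $k=\sum_{i=0}^r\binom{m}{i}$. Its standard generator matrix $\boldsymbol{G}\in\mathbb{F}_2^{k\times n}$ has one row for each monomial $\prod_{t\in T}v_t$ with $T\subseteq[m]$, $|T|\le r$ (ordered by increasing degree and, within each degree, in reverse lexicographic order of the variable indices), and one column for each point of $\mathbb{F}_2^m$ (in lexicographic order); each entry is the value of the monomial at the point. Recovery sets. The $k$ message symbols $s_1,\dots,s_k$ correspond to the $k$ rows of $\boldsymbol{G}$, and the $n$ servers correspond to its columns $\boldsymbol{g}_1,\dots,\boldsymbol{g}_n$. A message symbol has order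 $\ell$ if its row is indexed by a monomial of degree $\ell$. A set $R\subseteq[n]$ is a recovery set for $s_i$ if $\boldsymbol{e}_i$ is an $\mathbb{F}_2$-linear combination of the columns $\{\boldsymbol{g}_j: j\in R\}$ and no proper subset of $R$ has this property (i.e., recovery sets are taken to be minimal). Let $R_{i,1},\dots,R_{i,t_i}$ be all the recovery sets for $s_i$. Service rate region. All servers have capacity $1$. $\mathcal{S}(\boldsymbol{G})\subseteq\mathbb{R}_{\ge0}^k$ is the set of all $\boldsymbol{\lambda}=(\lambda_1,\dots,\lambda_k)\in\mathbb{R}_{\ge 0}^k$ for which there exist $\lambda_{i,j}\in\mathbb{R}_{\ge0}$ ($i\in[k]$, $j\in[t_i]$) with $\sum_{j=1}^{t_i}\lambda_{i,j}=\lambda_i$ for all $i\in[k]$, and $\sum_{i=1}^k\sum_{j\in[t_i]:\,\ell\in R_{i,j}}\lambda_{i,j}\le 1$ for all $\ell\in[n]$. *)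

theory Defs
  imports "Jordan_Normal_Form.Matrix" "HOL-Library.Z2"
begin

text \<open>
  The field with two elements is the type \<^typ>\<open>bit\<close>. Variables, message symbols (rows) and servers
  (columns) are numbered from 0.
\<close>

text \<open>
  A squarefree monomial is the increasing list of its variable indices. \<^const>\<open>subseqs\<close> lists the
  index lists of a given length in lexicographic order (see \<open>sorted_subseqs_of_length\<close> below), so
  \<^const>\<open>rev\<close> gives reverse lexicographic order within each degree.
\<close>

definition rm_monomials :: "nat \<Rightarrow> nat \<Rightarrow> nat list list" where
  "rm_monomials r m =
     concat (map (\<lambda>d. rev (filter (\<lambda>T. length T = d) (subseqs [0..<m]))) [0..<r + 1])"

text \<open>The first coordinate is the most significant one.\<close>

definition rm_points :: "nat \<Rightarrow> bit list list" where
  "rm_points m = product_lists (replicate m [0, 1])"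

definition monomial_value :: "nat list \<Rightarrow> bit list \<Rightarrow> bit" where
  "monomial_value T p = (\<Prod>t\<leftarrow>T. p ! t)"

definition rm_dim :: "nat \<Rightarrow> nat \<Rightarrow> nat" where
  "rm_dim r m = (\<Sum>i\<le>r. m choose i)"

definition rm_generator :: "nat \<Rightarrow> nat \<Rightarrow> bit mat" where
  "rm_generator r m =
     mat (rm_dim r m) (2 ^ m) (\<lambda>(i, j). monomial_value (rm_monomials r m ! i) (rm_points m ! j))"

definition symbol_order :: "nat \<Rightarrow> nat \<Rightarrow> nat \<Rightarrow> nat" where
  "symbol_order r m i = length (rm_monomials r m ! i)"

text \<open>
  \<open>G *\<^sub>v c\<close> is the combination of the columns of \<open>G\<close> with coefficients \<open>c\<close>; the coefficients are
  required to vanish outside \<open>R\<close>.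
\<close>

definition recovers :: "bit mat \<Rightarrow> nat \<Rightarrow> nat set \<Rightarrow> bool" where
  "recovers G i R \<longleftrightarrow>
     R \<subseteq> {..<dim_col G} \<and>
     (\<exists>c \<in> carrier_vec (dim_col G).
        (\<forall>j<dim_col G. j \<notin> R \<longrightarrow> c $ j = 0) \<and> G *\<^sub>v c = unit_vec (dim_row G) i)"

definition recovery_sets :: "bit mat \<Rightarrow> nat \<Rightarrow> nat set set" where
  "recovery_sets G i = {R. recovers G i R \<and> (\<forall>R'. R' \<subset> R \<longrightarrow> \<not> recovers G i R')}"

definition service_rate_region :: "bit mat \<Rightarrow> real vec set" where
  "service_rate_region G =
     {lam \<in> carrier_vec (dim_row G).
        (\<forall>i<dim_row G. 0 \<le> lam $ i) \<and>
        (\<exists>mu :: nat \<Rightarrow> nat set \<Rightarrow> real.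
           (\<forall>i<dim_row G. \<forall>R\<in>recovery_sets G i. 0 \<le> mu i R) \<and>
           (\<forall>i<dim_row G. (\<Sum>R\<in>recovery_sets G i. mu i R) = lam $ i) \<and>
           (\<forall>l<dim_col G. (\<Sum>i<dim_row G. \<Sum>R\<in>{R \<in> recovery_sets G i. l \<in> R}. mu i R) \<le> 1))}"

text \<open>Sanity checks: the sums above are finite, and rows and columns are enumerated as intended.\<close>

lemma finite_recovery_sets: "finite (recovery_sets G i)"
  by (rule finite_subset[of _ "Pow {..<dim_col G}"]) (auto simp: recovery_sets_def recovers_def)

lemma subseqs_increasing:
  "T \<in> set (subseqs xs) \<Longrightarrow> sorted_wrt (<) xs \<Longrightarrow> sorted_wrt (<) T \<and> set T \<subseteq> set xs"
  for xs :: "nat list"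
  by (induction xs arbitrary: T) (auto simp: Let_def, blast+)

lemma set_subseqs_increasing:
  fixes xs :: "nat list"
  assumes "sorted_wrt (<) xs"
  shows "set (subseqs xs) = {T. sorted_wrt (<) T \<and> set T \<subseteq> set xs}"
proof (intro equalityI subsetI)
  fix T assume "T \<in> {T. sorted_wrt (<) T \<and> set T \<subseteq> set xs}"
  moreover from this obtain T' where "T' \<in> set (subseqs xs)" "set T' = set T"
    using subset_subseqs[of "set T" xs] by auto
  ultimately show "T \<in> set (subseqs xs)"
    using subseqs_increasing[OF _ assms, of T'] strict_sorted_equal[of T T'] by auto
qed (use subseqs_increasing[OF _ assms] in auto)

lemma length_subseqs_of_length:
  "length (filter (\<lambda>T. length T = d) (subseqs xs)) = length xs choose d"
proof (induction xs arbitrary: d)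
  case Nil
  then show ?case by (cases d) auto
next
  case (Cons x xs)
  then show ?case using Cons.IH[of 0] by (cases d) (auto simp: Let_def filter_map o_def)
qed

lemma sorted_subseqs_of_length:
  "sorted_wrt (<) xs \<Longrightarrow>
   sorted_wrt (\<lambda>S T. (S, T) \<in> lexord {(x, y). x < y}) (filter (\<lambda>T. length T = d) (subseqs xs))"
  for xs :: "nat list"
proof (induction xs arbitrary: d)
  case Nil
  then show ?case by (cases d) auto
next
  case (Cons x xs)
  show ?case
  proof (cases d)
    case 0
    then show ?thesis using Cons.IH[of 0] Cons.prems by (simp add: Let_def filter_map o_def)
  next
    case (Suc e)
    have "(x # S, T) \<in> lexord {(x, y). x < y}"
      if "T \<in> set (subseqs xs)" "length T = Suc e" for S T
      using subseqs_increasing[OF that(1)] Cons.prems that(2) by (cases T) auto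
    moreover have "sorted_wrt (\<lambda>S T. (S, T) \<in> lexord {(x, y). x < y})
        (map ((#) x) (filter (\<lambda>T. length T = e) (subseqs xs)))"
      using Cons.IH[of e] Cons.prems by (simp add: sorted_wrt_map)
    ultimately show ?thesis
      using Suc Cons.IH[of d] Cons.prems
      by (auto simp: Let_def filter_map o_def sorted_wrt_append)
  qed
qed

lemma set_rm_monomials:
  "set (rm_monomials r m) = {T. sorted_wrt (<) T \<and> set T \<subseteq> {..<m} \<and> length T \<le> r}"
  using set_subseqs_increasing[of "[0..<m]"]
  by (auto simp: rm_monomials_def lessThan_atLeast0 less_Suc_eq_le)

lemma length_rm_monomials: "length (rm_monomials r m) = rm_dim r m"
  using length_subseqs_of_length[of 0 "[0..<m]"]
  by (induction r)
    (simp_all add: rm_monomials_def rm_dim_def length_subseqs_of_length atLeast0AtMost)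

lemma distinct_rm_monomials: "distinct (rm_monomials r m)"
proof (induction r)
  have d: "distinct (subseqs [0..<m])"
    using distinct_set_subseqs[of "[0..<m]"] by (simp add: distinct_map)
  {
    case 0
    show ?case using d by (simp add: rm_monomials_def)
  next
    case (Suc r)
    then show ?case using d by (auto simp: rm_monomials_def)
  }
qed

lemma length_rm_points: "length (rm_points m) = 2 ^ m"
  by (simp add: rm_points_def length_product_lists foldr_replicate) (induction m; simp)

lemma set_rm_points: "set (rm_points m) = {p. length p = m}"
  by (auto simp: rm_points_def product_lists_set list_all2_conv_all_nth)

lemma distinct_rm_points: "distinct (rm_points m)"
  unfolding rm_points_def by (intro distinct_product_lists) auto

end

theory Submission
  imports Defs
begin

text \<open>
  Let \<open>T\<close> be the monomial of a symbol of order \<open>l\<close>. The sum of the columns at the \<open>2 ^ l\<close> points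
  supported in \<open>T\<close> is the unit vector of \<open>T\<close>. The indicator of any other recovery set differs from
  the indicator of this cube by a nonzero word of the dual code, whose weight is at least
  \<open>2 ^ (r + 1)\<close>; so every other recovery set has at least \<open>2 ^ (r + 1) - 2 ^ l\<close> elements. The cubes
  of all symbols share the zero point, so the rates served by the cubes of two symbols add up to
  at most 1. Summing the loads over all \<open>2 ^ m\<close> servers gives the bound.
\<close>

section \<open>Set families and superset parities\<close>

text \<open>
  The minimum distance of the dual code, with points identified with their supports. Splitting \<open>F\<close>
  by a coordinate on which two of its members differ leaves both halves nonempty and lowers \<open>r\<close>
  by one.
\<close>

lemma even_superset_counts_imp_card_ge:
  assumes "finite V" "F \<subseteq> Pow V" "F \<noteq> {}"
    and "\<And>S. S \<subseteq> V \<Longrightarrow> card S \<le> r \<Longrightarrow> even (card {X \<in> F. S \<subseteq> X})"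
  shows "2 ^ (r + 1) \<le> card F"
  using assms(2-)
proof (induction r arbitrary: F)
  case 0
  have "finite F" using 0(1) assms(1) finite_subset by blast
  moreover have "even (card F)" using 0(3)[of "{}"] by simp
  ultimately show ?case using 0(2) by (cases "card F = 1") (auto simp: Suc_le_eq card_gt_0_iff numeral_2_eq_2 intro: Nat.Suc_lessI)
next
  case (Suc r)
  have fin: "finite F" using Suc.prems(1) assms(1) finite_subset by blast
  have "even (card F)" using Suc.prems(3)[of "{}"] by simp
  then have "card F \<noteq> 1" by auto
  then obtain X Y where XY: "X \<in> F" "Y \<in> F" "X \<noteq> Y"
    using Suc.prems(2) by (metis is_singletonI' is_singleton_altdef)
  \<comment> \<open>Two distinct sets differ in some \<open>v\<close>; from here on \<open>X\<close>
    names the one that contains it.\<close>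
  then obtain v X Y where v: "X \<in> F" "Y \<in> F" "v \<in> X" "v \<notin> Y" by blast
  have vV: "v \<in> V" using v Suc.prems(1) by auto
  define F0 F1 where "F0 = {X \<in> F. v \<notin> X}" and "F1 = {X \<in> F. v \<in> X}"
  \<comment> \<open>Members of \<open>F1\<close> contain \<open>v\<close> anyway, so testing
    \<open>S\<close> in \<open>F1\<close> amounts to testing \<open>insert v S\<close> in
    \<open>F\<close>; this uses up one unit of the allowed size.\<close>
  have even1: "even (card {X \<in> F1. S \<subseteq> X})" if "S \<subseteq> V" "card S \<le> r" for S
  proof -
    have "{X \<in> F1. S \<subseteq> X} = {X \<in> F. insert v S \<subseteq> X}" by (auto simp: F1_def)
    moreover have "card (insert v S) \<le> Suc r" using that by (simp add: card_insert_le_m1)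
    ultimately show ?thesis using Suc.prems(3)[of "insert v S"] that vV by simp
  qed
  \<comment> \<open>The count in \<open>F0\<close> is the even count in \<open>F\<close> minus the
    even count in \<open>F1\<close>.\<close>
  have even0: "even (card {X \<in> F0. S \<subseteq> X})" if "S \<subseteq> V" "card S \<le> r" for S
  proof -
    have "{X \<in> F. S \<subseteq> X} = {X \<in> F0. S \<subseteq> X} \<union> {X \<in> F1. S \<subseteq> X}"
      by (auto simp: F0_def F1_def)
    moreover have "{X \<in> F0. S \<subseteq> X} \<inter> {X \<in> F1. S \<subseteq> X} = {}" by (auto simp: F0_def F1_def)
    ultimately have "card {X \<in> F. S \<subseteq> X} = card {X \<in> F0. S \<subseteq> X} + card {X \<in> F1. S \<subseteq> X}"
      using fin by (simp add: card_Un_disjoint F0_def F1_def)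
    then show ?thesis using even1[OF that] Suc.prems(3)[of S] that by simp
  qed
  have "2 ^ (r + 1) \<le> card F0"
    by (rule Suc.IH[OF _ _ even0]) (use Suc.prems v in \<open>auto simp: F0_def\<close>)
  moreover have "2 ^ (r + 1) \<le> card F1"
    by (rule Suc.IH[OF _ _ even1]) (use Suc.prems v in \<open>auto simp: F1_def\<close>)
  moreover have "card F = card F0 + card F1"
  proof -
    have "F = F0 \<union> F1" "F0 \<inter> F1 = {}" by (auto simp: F0_def F1_def)
    then show ?thesis using fin by (metis card_Un_disjoint finite_Un)
  qed
  ultimately show ?case by simp
qed

text \<open>For \<open>S\<close> inside \<open>T\<close> the sets in between correspond to the
  subsets of \<open>T - S\<close>, so their number is a power of two, odd only for exponent 0;
  otherwise there are none.\<close>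

lemma odd_card_interval_iff:
  assumes "finite T"
  shows "odd (card {X. S \<subseteq> X \<and> X \<subseteq> T}) \<longleftrightarrow> S = T"
proof (cases "S \<subseteq> T")
  case True
  have "bij_betw ((\<union>) S) (Pow (T - S)) {X. S \<subseteq> X \<and> X \<subseteq> T}"
    by (rule bij_betwI[where g = "\<lambda>X. X - S"]) (use True in auto)
  then have "card {X. S \<subseteq> X \<and> X \<subseteq> T} = 2 ^ card (T - S)"
    using assms by (metis bij_betw_same_card card_Pow finite_Diff)
  moreover have "card (T - S) = 0 \<longleftrightarrow> S = T" using assms True by auto
  ultimately show ?thesis by simp
next
  case False
  then have "{X. S \<subseteq> X \<and> X \<subseteq> T} = {}" by auto
  then have "card {X. S \<subseteq> X \<and> X \<subseteq> T} = 0" by (simp only: card.empty)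
  with False show ?thesis by auto
qed

section \<open>Points as sets, matrix rows as parities\<close>

definition rm_point_supp :: "nat \<Rightarrow> nat \<Rightarrow> nat set" where
  "rm_point_supp m q = {t. t < m \<and> rm_points m ! q ! t = 1}"

lemma bij_betw_rm_point_supp: "bij_betw (rm_point_supp m) {..<2 ^ m} (Pow {..<m})"
proof -
  have "bij_betw ((!) (rm_points m)) {..<2 ^ m} {p. length p = m}"
    by (rule bij_betw_nth) (auto simp: length_rm_points set_rm_points distinct_rm_points)
  moreover have "bij_betw (\<lambda>p. {t. t < m \<and> p ! t = (1 :: bit)}) {p. length p = m} (Pow {..<m})"
    by (rule bij_betwI[where g = "\<lambda>X. map (\<lambda>t. of_bool (t \<in> X)) [0..<m]"])
      (auto intro!: nth_equalityI)
  ultimately have "bij_betw ((\<lambda>p. {t. t < m \<and> p ! t = (1 :: bit)}) \<circ> (!) (rm_points m))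
      {..<2 ^ m} (Pow {..<m})"
    by (rule bij_betw_trans)
  then show ?thesis by (simp add: rm_point_supp_def[abs_def] comp_def)
qed

lemma monomial_value_eq_of_bool: "monomial_value T p = of_bool (\<forall>t \<in> set T. p ! t = 1)"
  by (induction T) (auto simp: monomial_value_def)

lemma of_nat_bit_eq_of_bool: "(of_nat n :: bit) = of_bool (odd n)"
  by (induction n) auto

text \<open>A monomial is 1 at a point exactly when its variables lie in the support of the point. A
  row applied to \<open>c\<close> therefore counts supports modulo 2, which turns linear algebra
  into parity counting.\<close>

lemma rm_generator_mult_vec_nth:
  assumes "c \<in> carrier_vec (2 ^ m)" "i < rm_dim r m"
  defines "F \<equiv> rm_point_supp m ` {q. q < 2 ^ m \<and> c $ q = 1}"
  shows "(rm_generator r m *\<^sub>v c) $ i =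
    of_bool (odd (card {X \<in> F. set (rm_monomials r m ! i) \<subseteq> X}))"
proof -
  let ?T = "rm_monomials r m ! i"
  let ?Q = "{q. q < 2 ^ m \<and> c $ q = 1 \<and> set ?T \<subseteq> rm_point_supp m q}"
  have "?T \<in> set (rm_monomials r m)" using assms(2) by (simp add: length_rm_monomials)
  then have sub: "set ?T \<subseteq> {..<m}" by (auto simp: set_rm_monomials)
  have inj: "inj_on (rm_point_supp m) {..<2 ^ m}"
    using bij_betw_rm_point_supp bij_betw_imp_inj_on by blast
  have "(rm_generator r m *\<^sub>v c) $ i =
      (\<Sum>q<2 ^ m. monomial_value ?T (rm_points m ! q) * c $ q)"
    using assms(1,2)
    by (auto simp: rm_generator_def scalar_prod_def lessThan_atLeast0 intro!: sum.cong)
  also have "\<dots> = (\<Sum>q<2 ^ m. of_bool (q \<in> ?Q))"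
    using sub by (intro sum.cong) (auto simp: monomial_value_eq_of_bool rm_point_supp_def)
  also have "\<dots> = of_nat (card ?Q)"
    by (subst sum_of_bool_eq) (auto simp: Int_def intro!: arg_cong[where f = card])
  \<comment> \<open>Passing from servers to supports keeps the count, since
    \<open>rm_point_supp\<close> is injective.\<close>
  also have "card ?Q = card (rm_point_supp m ` ?Q)"
    by (rule card_image[symmetric]) (use inj in \<open>auto intro: inj_on_subset\<close>)
  also have "rm_point_supp m ` ?Q = {X \<in> F. set ?T \<subseteq> X}" by (auto simp: F_def)
  finally show ?thesis by (simp add: of_nat_bit_eq_of_bool)
qed

text \<open>Every set of at most \<open>r\<close> variables indexes a row, so a kernel vector yields
  a family with all the even counts that \<open>even_superset_counts_imp_card_ge\<close> asks
  for.\<close>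

lemma rm_dual_weight_ge:
  assumes "c \<in> carrier_vec (2 ^ m)" "c \<noteq> 0\<^sub>v (2 ^ m)"
    and "rm_generator r m *\<^sub>v c = 0\<^sub>v (rm_dim r m)"
  shows "2 ^ (r + 1) \<le> card {q. q < 2 ^ m \<and> c $ q = 1}"
proof -
  let ?Q = "{q. q < 2 ^ m \<and> c $ q = 1}"
  let ?F = "rm_point_supp m ` ?Q"
  have "?Q \<noteq> {}"
  proof
    assume "?Q = {}"
    then have "c = 0\<^sub>v (2 ^ m)" using assms(1) by (intro eq_vecI) auto
    with assms(2) show False ..
  qed
  then have "2 ^ (r + 1) \<le> card ?F"
  proof (intro even_superset_counts_imp_card_ge[of "{..<m}"])
    fix S assume S: "S \<subseteq> {..<m}" "card S \<le> r"
    then have "finite S" using finite_subset by blast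
    then have "sorted_list_of_set S \<in> set (rm_monomials r m)"
      using S by (simp add: set_rm_monomials)
    then obtain i where i: "i < rm_dim r m" "rm_monomials r m ! i = sorted_list_of_set S"
      by (auto simp: in_set_conv_nth length_rm_monomials)
    then show "even (card {X \<in> ?F. S \<subseteq> X})"
      using rm_generator_mult_vec_nth[OF assms(1) i(1)] assms(3) \<open>finite S\<close>
      by (simp split: if_splits)
  qed (auto simp: rm_point_supp_def)
  also have "\<dots> \<le> card ?Q" by (rule card_image_le) simp
  finally show ?thesis .
qed

text \<open>By minimality: the support of a coefficient vector that vanishes outside
  \<open>R\<close> already recovers, so it is all of \<open>R\<close>. Recovery sets can thus be
  compared by adding vectors.\<close>

lemma recovery_setsE:
  assumes "R \<in> recovery_sets G i"
  obtains c where "c \<in> carrier_vec (dim_col G)" "G *\<^sub>v c = unit_vec (dim_row G) i"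
    "R = {q. q < dim_col G \<and> c $ q = 1}"
proof -
  from assms obtain c where c: "c \<in> carrier_vec (dim_col G)"
      "\<forall>j<dim_col G. j \<notin> R \<longrightarrow> c $ j = 0" "G *\<^sub>v c = unit_vec (dim_row G) i"
    by (auto simp: recovery_sets_def recovers_def)
  let ?Q = "{q. q < dim_col G \<and> c $ q = 1}"
  have "recovers G i ?Q" unfolding recovers_def using c by auto
  moreover have "?Q \<subseteq> R" using c(2) by auto
  ultimately have "?Q = R" using assms by (auto simp: recovery_sets_def)
  with c show ?thesis using that by blast
qed

section \<open>Cubes and the sizes of recovery sets\<close>

lemma dim_rm_generator [simp]:
  "dim_row (rm_generator r m) = rm_dim r m" "dim_col (rm_generator r m) = 2 ^ m"
  by (simp_all add: rm_generator_def)

definition rm_cube :: "nat \<Rightarrow> nat \<Rightarrow> nat \<Rightarrow> nat set" where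
  "rm_cube r m i = {q. q < 2 ^ m \<and> rm_point_supp m q \<subseteq> set (rm_monomials r m ! i)}"

lemma set_rm_monomials_nth:
  assumes "i < rm_dim r m"
  shows "set (rm_monomials r m ! i) \<subseteq> {..<m}"
    and "card (set (rm_monomials r m ! i)) = symbol_order r m i"
proof -
  have "rm_monomials r m ! i \<in> set (rm_monomials r m)" using assms by (simp add: length_rm_monomials)
  then show "set (rm_monomials r m ! i) \<subseteq> {..<m}"
    and "card (set (rm_monomials r m ! i)) = symbol_order r m i"
    by (auto simp: set_rm_monomials symbol_order_def strict_sorted_iff distinct_card)
qed

lemma inj_on_set_rm_monomials: "inj_on (\<lambda>i. set (rm_monomials r m ! i)) {..<rm_dim r m}"
proof (rule inj_onI)
  fix i j assume ij: "i \<in> {..<rm_dim r m}" "j \<in> {..<rm_dim r m}"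
    and eq: "set (rm_monomials r m ! i) = set (rm_monomials r m ! j)"
  have "rm_monomials r m ! i \<in> set (rm_monomials r m)" "rm_monomials r m ! j \<in> set (rm_monomials r m)"
    using ij by (simp_all add: length_rm_monomials)
  then have "rm_monomials r m ! i = rm_monomials r m ! j"
    using eq by (intro strict_sorted_equal) (auto simp: set_rm_monomials)
  then show "i = j" using ij distinct_rm_monomials
    by (simp add: nth_eq_iff_index_eq length_rm_monomials)
qed

lemma image_rm_cube:
  assumes "i < rm_dim r m"
  shows "rm_point_supp m ` rm_cube r m i = Pow (set (rm_monomials r m ! i))"
proof -
  have "rm_point_supp m ` {..<2 ^ m} = Pow {..<m}"
    using bij_betw_rm_point_supp bij_betw_imp_surj_on by blast
  moreover have "rm_point_supp m ` rm_cube r m i =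
      rm_point_supp m ` {..<2 ^ m} \<inter> Pow (set (rm_monomials r m ! i))"
    by (auto simp: rm_cube_def)
  ultimately show ?thesis using set_rm_monomials_nth(1)[OF assms] by auto
qed

lemma card_rm_cube:
  assumes "i < rm_dim r m"
  shows "card (rm_cube r m i) = 2 ^ symbol_order r m i"
proof -
  have "inj_on (rm_point_supp m) (rm_cube r m i)"
    by (rule inj_on_subset[OF bij_betw_imp_inj_on[OF bij_betw_rm_point_supp]]) (auto simp: rm_cube_def)
  then show ?thesis
    using image_rm_cube[OF assms] set_rm_monomials_nth(2)[OF assms]
    by (metis card_Pow card_image List.finite_set)
qed

text \<open>The entry in row \<open>i'\<close> is the parity of the number of sets between two
  monomials, which is odd only if they coincide.\<close>

lemma rm_generator_mult_cube:
  assumes "i < rm_dim r m"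
  shows "rm_generator r m *\<^sub>v vec (2 ^ m) (\<lambda>q. of_bool (q \<in> rm_cube r m i)) = unit_vec (rm_dim r m) i"
    (is "_ *\<^sub>v ?c = _")
proof (rule eq_vecI)
  fix i' assume "i' < dim_vec (unit_vec (rm_dim r m) i :: bit vec)"
  then have i': "i' < rm_dim r m" by simp
  let ?S = "set (rm_monomials r m ! i')" and ?T = "set (rm_monomials r m ! i)"
  have "{q. q < 2 ^ m \<and> ?c $ q = 1} = rm_cube r m i" by (auto simp: rm_cube_def)
  then have "(rm_generator r m *\<^sub>v ?c) $ i' = of_bool (odd (card {X. ?S \<subseteq> X \<and> X \<subseteq> ?T}))"
    by (subst rm_generator_mult_vec_nth[OF _ i']) (auto simp: image_rm_cube[OF assms] conj_commute)
  also have "\<dots> = of_bool (?S = ?T)" by (simp only: odd_card_interval_iff List.finite_set)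
  also have "?S = ?T \<longleftrightarrow> i' = i"
    using inj_on_set_rm_monomials[of r m] i' assms by (auto dest: inj_onD)
  finally show "(rm_generator r m *\<^sub>v ?c) $ i' = unit_vec (rm_dim r m) i $ i'"
    using i' assms by simp
qed simp

lemma card_recovery_set_ge:
  assumes "i < rm_dim r m" "R \<in> recovery_sets (rm_generator r m) i" "R \<noteq> rm_cube r m i"
  shows "2 ^ (r + 1) \<le> card R + 2 ^ symbol_order r m i"
proof -
  let ?A = "rm_cube r m i" and ?G = "rm_generator r m"
  define a :: "bit vec" where "a = vec (2 ^ m) (\<lambda>q. of_bool (q \<in> ?A))"
  obtain c where c: "c \<in> carrier_vec (2 ^ m)" "?G *\<^sub>v c = unit_vec (rm_dim r m) i"
    "R = {q. q < 2 ^ m \<and> c $ q = 1}"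
    using recovery_setsE[OF assms(2)] by auto
  have a: "a \<in> carrier_vec (2 ^ m)" "{q. q < 2 ^ m \<and> a $ q = 1} = ?A"
    by (auto simp: a_def rm_cube_def)
  have "?G *\<^sub>v (c + a) = unit_vec (rm_dim r m) i + unit_vec (rm_dim r m) i"
    using mult_add_distrib_mat_vec[of ?G "rm_dim r m" "2 ^ m" c a] c a(1)
      rm_generator_mult_cube[OF assms(1)] by (simp add: a_def carrier_matI)
  \<comment> \<open>In characteristic 2 a vector added to itself vanishes, so \<open>c + a\<close>
    is a dual word.\<close>
  also have "\<dots> = 0\<^sub>v (rm_dim r m)" by (intro eq_vecI) auto
  finally have ker: "?G *\<^sub>v (c + a) = 0\<^sub>v (rm_dim r m)" .
  have "c + a \<noteq> 0\<^sub>v (2 ^ m)"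
  proof
    assume z: "c + a = 0\<^sub>v (2 ^ m)"
    have "c $ q = a $ q" if "q < 2 ^ m" for q
      using arg_cong[OF z, of "\<lambda>v. v $ q"] that c(1) a(1) by (cases "c $ q"; cases "a $ q") auto
    then have "R = {q. q < 2 ^ m \<and> a $ q = 1}" unfolding c(3) by (intro Collect_cong) auto
    then have "R = ?A" by (simp only: a(2))
    with assms(3) show False ..
  qed
  then have "2 ^ (r + 1) \<le> card {q. q < 2 ^ m \<and> (c + a) $ q = 1}"
    using rm_dual_weight_ge[OF _ _ ker] c(1) a(1) by simp
  \<comment> \<open>Where the sum is 1, one of the two vectors is 1.\<close>
  also have "\<dots> \<le> card (R \<union> ?A)"
  proof (rule card_mono)
    show "finite (R \<union> ?A)" by (simp add: c(3) rm_cube_def)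
    show "{q. q < 2 ^ m \<and> (c + a) $ q = 1} \<subseteq> R \<union> ?A"
      unfolding c(3) a(2)[symmetric] using c(1) a(1) by auto
  qed
  also have "\<dots> \<le> card R + card ?A" by (rule card_Un_le)
  finally show ?thesis by (simp add: card_rm_cube[OF assms(1)])
qed

text \<open>Brings all recovery sets under one linear bound. With \<open>l\<close> the order, a cube
  has \<open>2 ^ l\<close> elements and falls short of \<open>2 ^ (r + 1) - 2 ^ l\<close> by
  \<open>2 ^ (r + 1) - 2 ^ (l + 1)\<close>. Every cube contains the zero point \<open>z\<close>, so
  this shortfall is charged to \<open>z\<close>; for other sets the extra term is nonnegative
  because \<open>l \<le> r\<close>.\<close>

lemma card_recovery_set_ge_real:
  assumes "i < rm_dim r m" "R \<in> recovery_sets (rm_generator r m) i"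
    and "symbol_order r m i \<le> r" "z < 2 ^ m" "rm_point_supp m z = {}"
  shows "2 ^ (r + 1) - 2 ^ symbol_order r m i
      \<le> real (card R) + (2 ^ (r + 1) - 2 ^ (symbol_order r m i + 1)) * of_bool (z \<in> R)"
proof (cases "R = rm_cube r m i")
  case True
  then have "z \<in> R" using assms(4,5) by (simp add: rm_cube_def)
  then show ?thesis using True card_rm_cube[OF assms(1)] by simp
next
  case False
  have "2 ^ (symbol_order r m i + 1) \<le> (2 ^ (r + 1) :: real)"
    by (rule power_increasing) (use assms(3) in auto)
  then have "0 \<le> (2 ^ (r + 1) - 2 ^ (symbol_order r m i + 1)) * (of_bool (z \<in> R) :: real)"
    by (intro mult_nonneg_nonneg) (linarith, simp)
  moreover have "real (2 ^ (r + 1)) \<le> real (card R + 2 ^ symbol_order r m i)"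
    using card_recovery_set_ge[OF assms(1,2) False] by (rule of_nat_mono)
  then have "2 ^ (r + 1) \<le> real (card R) + 2 ^ symbol_order r m i" by simp
  ultimately show ?thesis by linarith
qed

section \<open>Double counting of the server loads\<close>

theorem theorem3:
  fixes r m i j l1 l2 :: nat and lam :: "real vec"
  assumes "m \<ge> r + 1"
    and "lam \<in> service_rate_region (rm_generator r m)"
    and "i < rm_dim r m" and "j < rm_dim r m"
    and "symbol_order r m i = l1" and "symbol_order r m j = l2"
    and "l1 < l2" and "l2 \<le> r"
  shows "(2 ^ (r + 1) - 2 ^ l1) * lam $ i + (2 ^ (r + 1) - 2 ^ l2) * lam $ j
      \<le> (2 ^ m + 2 ^ (r + 1) - 2 ^ (l1 + 1) :: real)"
proof -
  let ?G = "rm_generator r m"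
  let ?k = "rm_dim r m"
  let ?RS = "recovery_sets ?G"
  obtain mu :: "nat \<Rightarrow> nat set \<Rightarrow> real" where
    mu0: "\<And>x R. x < ?k \<Longrightarrow> R \<in> ?RS x \<Longrightarrow> 0 \<le> mu x R" and
    mulam: "\<And>x. x < ?k \<Longrightarrow> (\<Sum>R\<in>?RS x. mu x R) = lam $ x" and
    cap: "\<And>l. l < 2 ^ m \<Longrightarrow> (\<Sum>x<?k. \<Sum>R\<in>{R \<in> ?RS x. l \<in> R}. mu x R) \<le> 1"
    using assms(2) by (auto simp: service_rate_region_def)
  have "{} \<in> rm_point_supp m ` {..<2 ^ m}"
    using bij_betw_rm_point_supp[of m] by (simp add: bij_betw_def)
  then obtain z where z: "z < 2 ^ m" "rm_point_supp m z = {}" by auto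
  define load where "load x l = (\<Sum>R\<in>{R \<in> ?RS x. l \<in> R}. mu x R)" for x l
  have load0: "0 \<le> load x l" if "x < ?k" for x l
    unfolding load_def using mu0[OF that] by (intro sum_nonneg) auto
  \<comment> \<open>The capacity of one server, after dropping the nonnegative loads of the other
    symbols.\<close>
  have pair: "load i l + load j l \<le> 1" if "l < 2 ^ m" for l
  proof -
    have "i \<noteq> j" using assms(5-7) by auto
    then have "load i l + load j l = (\<Sum>x\<in>{i, j}. load x l)" by simp
    also have "\<dots> \<le> (\<Sum>x<?k. load x l)"
      by (rule sum_mono2) (use assms(3,4) load0 in auto)
    also have "\<dots> \<le> 1" using cap[OF that] by (simp add: load_def)
    finally show ?thesis .
  qed
  \<comment> \<open>Double counting: a set \<open>R\<close> puts load \<open>mu x R\<close> on each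
    of its \<open>card R\<close> servers.\<close>
  have total: "(\<Sum>l<2 ^ m. load x l) = (\<Sum>R\<in>?RS x. card R * mu x R)" for x
  proof -
    have "(\<Sum>l<2 ^ m. load x l) = (\<Sum>R\<in>?RS x. \<Sum>l\<in>{l. l < 2 ^ m \<and> l \<in> R}. mu x R)"
      unfolding load_def by (subst sum.swap_restrict) (auto simp: finite_recovery_sets)
    also have "\<dots> = (\<Sum>R\<in>?RS x. card R * mu x R)"
    proof (rule sum.cong)
      fix R assume "R \<in> ?RS x"
      then have "{l. l < 2 ^ m \<and> l \<in> R} = R" by (auto simp: recovery_sets_def recovers_def)
      then show "(\<Sum>l\<in>{l. l < 2 ^ m \<and> l \<in> R}. mu x R) = card R * mu x R" by simp
    qed simp
    finally show ?thesis .
  qed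
  \<comment> \<open>The size bound is summed with weights \<open>mu x R\<close>; the terms with
    \<open>z \<in> R\<close> add up to the load on the server \<open>z\<close>.\<close>
  have bound: "(2 ^ (r + 1) - 2 ^ symbol_order r m x) * lam $ x
      \<le> (\<Sum>l<2 ^ m. load x l) + (2 ^ (r + 1) - 2 ^ (symbol_order r m x + 1)) * load x z"
    if x: "x < ?k" "symbol_order r m x \<le> r" for x
  proof -
    let ?d = "2 ^ (r + 1) - 2 ^ (symbol_order r m x + 1) :: real"
    have "(2 ^ (r + 1) - 2 ^ symbol_order r m x) * lam $ x
        = (\<Sum>R\<in>?RS x. (2 ^ (r + 1) - 2 ^ symbol_order r m x) * mu x R)"
      by (simp add: mulam[OF x(1), symmetric] sum_distrib_left)
    also have "\<dots> \<le> (\<Sum>R\<in>?RS x. (card R + ?d * of_bool (z \<in> R)) * mu x R)"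
      by (intro sum_mono mult_right_mono card_recovery_set_ge_real x z mu0)
    also have "\<dots> = (\<Sum>l<2 ^ m. load x l) + ?d * (\<Sum>R\<in>?RS x. of_bool (z \<in> R) * mu x R)"
      by (simp only: total distrib_right sum.distrib sum_distrib_left mult.assoc)
    also have "(\<Sum>R\<in>?RS x. of_bool (z \<in> R) * mu x R) = load x z"
      unfolding load_def sum.inter_filter[OF finite_recovery_sets] by (intro sum.cong) auto
    finally show ?thesis .
  qed
  have "(\<Sum>l<2 ^ m. load i l) + (\<Sum>l<2 ^ m. load j l) \<le> (\<Sum>l<2 ^ m :: nat. 1)"
    unfolding sum.distrib[symmetric] by (rule sum_mono) (simp add: pair)
  then have tot: "(\<Sum>l<2 ^ m. load i l) + (\<Sum>l<2 ^ m. load j l) \<le> 2 ^ m" by simp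
  \<comment> \<open>The corrections at \<open>z\<close> have different coefficients. As
    \<open>l1 < l2\<close>, both are at most \<open>?d1\<close>, which is why the right-hand side
    involves \<open>l1\<close> only; the capacity of \<open>z\<close> then bounds their sum by
    \<open>?d1\<close>.\<close>
  let ?d1 = "2 ^ (r + 1) - 2 ^ (l1 + 1) :: real" and ?d2 = "2 ^ (r + 1) - 2 ^ (l2 + 1) :: real"
  have "2 ^ (l1 + 1) \<le> (2 ^ (l2 + 1) :: real)" "2 ^ (l2 + 1) \<le> (2 ^ (r + 1) :: real)"
    by (rule power_increasing; use assms(7,8) in simp)+
  then have d: "0 \<le> ?d1" "?d2 \<le> ?d1" by linarith+
  have "?d1 * load i z + ?d2 * load j z \<le> ?d1 * load i z + ?d1 * load j z"
    by (intro add_left_mono mult_right_mono d load0 assms(4))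
  also have "\<dots> = ?d1 * (load i z + load j z)" by (simp add: distrib_left)
  also have "\<dots> \<le> ?d1" using mult_left_mono[OF pair[OF z(1)] d(1)] by simp
  finally have "?d1 * load i z + ?d2 * load j z \<le> ?d1" .
  \<comment> \<open>Adding the two instances of \<open>bound\<close> gives \<open>2 ^ m\<close> from
    the total load and \<open>?d1\<close> from the server \<open>z\<close>.\<close>
  with bound[OF assms(3)] bound[OF assms(4)] tot assms(5-8) show ?thesis by simp
qed

end
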